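(* Let $\mathcal{A}$ be an $m$-homogeneous supersolvable line arrangement in the complex projective plane $\mathbb{P}^2$, consisting of $d=|\mathcal{A}|$ lines and having at least two modular points. Then $n_2\ge \frac{d}{2}$, where $n_2$ is the number of double points of $\mathcal{A}$.
   Context: A line arrangement in $\mathbb{P}^2$ is a finite set of distinct lines. An intersection point is a point lying on at least two lines of the arrangement; its multiplicity is the number of lines through it, and a double point is an intersection point of multiplicity exactly $2$. An intersection point $p$ is modular if for every other intersection point $q$ the line $\overline{pq}$ belongs to the arrangement. The arrangement is supersolvable if it has a modular point, and it is $m$-homogeneous supersolvable if it is supersolvable and all its modular points have the same multiplicity $m$. *)

theory Defs
  imports "HOL-Analysis.Analysis"
begin

text \<open>
  Points and lines of the complex projective plane are the one- and two-dimensional complex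
  linear subspaces of \<open>complex ^ 3\<close>; incidence is inclusion. The operations
  \<open>vec.subspace\<close>, \<open>vec.dim\<close> and \<open>vec.span\<close> are taken over the field of scalars
  \<^typ>\<open>complex\<close>, unlike \<open>subspace\<close>, \<open>dim\<close> and \<open>span\<close>, which are over the reals.
\<close>

type_synonym flat = "(complex ^ 3) set"

definition proj_points :: "flat set" where
  "proj_points = {p. vec.subspace p \<and> vec.dim p = 1}"

definition proj_lines :: "flat set" where
  "proj_lines = {L. vec.subspace L \<and> vec.dim L = 2}"

definition line_through :: "flat \<Rightarrow> flat \<Rightarrow> flat" where
  "line_through p q = vec.span (p \<union> q)"

definition line_arrangement :: "flat set \<Rightarrow> bool" where
  "line_arrangement A \<longleftrightarrow> finite A \<and> A \<subseteq> proj_lines"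

definition multiplicity_at :: "flat set \<Rightarrow> flat \<Rightarrow> nat" where
  "multiplicity_at A p = card {L \<in> A. p \<subseteq> L}"

definition intersection_points :: "flat set \<Rightarrow> flat set" where
  "intersection_points A = {p \<in> proj_points. multiplicity_at A p \<ge> 2}"

definition double_points :: "flat set \<Rightarrow> flat set" where
  "double_points A = {p \<in> intersection_points A. multiplicity_at A p = 2}"

definition modular_points :: "flat set \<Rightarrow> flat set" where
  "modular_points A =
    {p \<in> intersection_points A. \<forall>q \<in> intersection_points A. q \<noteq> p \<longrightarrow> line_through p q \<in> A}"

definition supersolvable :: "flat set \<Rightarrow> bool" where
  "supersolvable A \<longleftrightarrow> modular_points A \<noteq> {}"

definition homogeneous_supersolvable :: "nat \<Rightarrow> flat set \<Rightarrow> bool" where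
  "homogeneous_supersolvable m A \<longleftrightarrow>
    supersolvable A \<and> (\<forall>p \<in> modular_points A. multiplicity_at A p = m)"

end

theory Submission
  imports Defs
begin

text \<open>
  Put the line \<open>L\<close> joining two modular points at infinity and let these points be the horizontal and
  the vertical direction. Modularity forces every affine intersection point onto the grid \<open>X \<times> Y\<close>
  cut out by the horizontal and vertical lines of the arrangement, so each of the remaining lines is
  the graph of an affine bijection \<open>X \<rightarrow> Y\<close>. In characteristic zero such a bijection maps the
  barycentre of \<open>X\<close> to that of \<open>Y\<close>; hence all the remaining lines are concurrent, their
  intersections with \<open>L\<close> are pairwise distinct double points, and the grid points which share exactly
  one coordinate with the common point are double points as well.
\<close>

section \<open>Affine bijections between finite sets\<close>

text \<open>A pair \<open>(s, t)\<close> encodes the line of slope \<open>s\<close> and intercept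
  \<open>t\<close>. The grid points off all these lines will be the double points in which one
  vertical and one horizontal line meet.\<close>

definition free_grid_points :: "'a::field set \<Rightarrow> 'a set \<Rightarrow> ('a \<times> 'a) set \<Rightarrow> ('a \<times> 'a) set" where
  "free_grid_points X Y R = {(x, y) \<in> X \<times> Y. \<forall>(s, t) \<in> R. y \<noteq> s * x + t}"

text \<open>The affine picture over any field of characteristic zero. \<open>card_eq\<close> is what
  equal multiplicity of the two modular points provides; \<open>maps_to\<close> and
  \<open>meet\<close> are what their modularity provides.\<close>

locale affine_bijections =
  fixes X Y :: "'a::field_char_0 set" and R :: "('a \<times> 'a) set"
  assumes finite_X: "finite X" and finite_Y: "finite Y" and finite_R: "finite R"
    and card_eq: "card X = card Y" and X_nonempty: "X \<noteq> {}"
    and slope_nonzero: "(s, t) \<in> R \<Longrightarrow> s \<noteq> 0"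
    and maps_to: "(s, t) \<in> R \<Longrightarrow> x \<in> X \<Longrightarrow> s * x + t \<in> Y"
    and meet: "(s, t) \<in> R \<Longrightarrow> (s', t') \<in> R \<Longrightarrow> (s, t) \<noteq> (s', t') \<Longrightarrow>
      s * x + t = s' * x + t' \<Longrightarrow> x \<in> X"
begin

lemma card_X_nonzero: "card X \<noteq> 0"
  using finite_X X_nonempty by simp

text \<open>An injective map between finite sets of equal size is onto, so summing its values over
  \<open>X\<close> yields the sum of \<open>Y\<close>.\<close>

lemma sum_image:
  assumes "(s, t) \<in> R"
  shows "s * \<Sum>X + of_nat (card X) * t = \<Sum>Y"
proof -
  have inj: "inj_on (\<lambda>x. s * x + t) X"
    using slope_nonzero[OF assms] by (auto simp: inj_on_def)
  have "(\<lambda>x. s * x + t) ` X = Y"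
    using maps_to[OF assms] finite_Y card_eq card_image[OF inj]
    by (intro card_subset_eq) auto
  then have "\<Sum>Y = (\<Sum>x\<in>X. s * x + t)"
    using sum.reindex[OF inj, of id] by simp
  then show ?thesis
    by (simp add: sum.distrib sum_distrib_left)
qed

text \<open>Comparing the two sums leaves \<open>card X * t = card X * t'\<close>, and
  \<open>card X\<close> is invertible in characteristic zero. Hence no two lines of \<open>R\<close>
  share a point at infinity.\<close>

lemma slope_determines:
  assumes "(s, t) \<in> R" "(s, t') \<in> R"
  shows "t = t'"
  using sum_image[OF assms(1)] sum_image[OF assms(2)] card_X_nonzero
  by (metis add_left_cancel mult_left_cancel of_nat_eq_0_iff)

lemma inj_on_slope: "inj_on fst R"
  using slope_determines by (auto simp: inj_on_def)

text \<open>Dividing \<open>sum_image\<close> by \<open>card X\<close> shows that every line passes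
  through the pair of barycentres. Two lines make it a meeting point, which \<open>meet\<close> and
  \<open>maps_to\<close> place on the grid.\<close>

lemma concurrent:
  assumes "card R \<ge> 2"
  obtains x0 y0 where "x0 \<in> X" "y0 \<in> Y" "\<And>s t. (s, t) \<in> R \<Longrightarrow> y0 = s * x0 + t"
proof -
  define x0 where "x0 = \<Sum>X / of_nat (card X)"
  define y0 where "y0 = \<Sum>Y / of_nat (card X)"
  have through: "y0 = s * x0 + t" if "(s, t) \<in> R" for s t
    using sum_image[OF that] card_X_nonzero
    by (simp add: x0_def y0_def field_simps)
  obtain a b where ab: "a \<in> R" "b \<in> R" "a \<noteq> b"
    using assms card_le_Suc0_iff_eq[OF finite_R] by fastforce
  obtain s t s' t' where st: "a = (s, t)" "b = (s', t')"
    by fastforce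
  have "x0 \<in> X"
    using meet[of s t s' t' x0] through[of s t] through[of s' t'] ab st by auto
  moreover have "y0 \<in> Y"
    using maps_to[of s t x0] through[of s t] \<open>x0 \<in> X\<close> ab st by auto
  ultimately show ?thesis
    using that through by blast
qed

lemma finite_free_grid_points: "finite (free_grid_points X Y R)"
  by (rule finite_subset[of _ "X \<times> Y"]) (auto simp: free_grid_points_def finite_X finite_Y)

text \<open>The left side will be the number of all lines; the bracket on the right counts double
  points at infinity and on the grid. A one-point grid with empty \<open>R\<close> violates the
  inequality.\<close>

lemma card_free_grid_points:
  assumes "card X \<ge> 2"
  shows "2 * card X + 1 + card R \<le> 2 * (card R + card (free_grid_points X Y R))"
proof -
  define n where "n = card X"
  have n: "n \<ge> 2" "card X = n" "card Y = n"
    using assms card_eq by (auto simp: n_def)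
  \<comment> \<open>Naming the square keeps the closing arithmetic linear.\<close>
  obtain N where N: "N = n * n" and sq: "2 * n \<le> N"
    using n by simp
  \<comment> \<open>Concurrency needs two lines, so the cases of no line and of one line are counted
    directly.\<close>
  consider "R = {}" | st where "R = {st}" | "card R \<ge> 2"
  proof -
    have "card R = 0 \<or> card R = 1 \<or> card R \<ge> 2"
      by linarith
    then show ?thesis
      using that finite_R by (metis card_1_singletonE card_0_eq)
  qed
  then show ?thesis
  proof cases
    case 1
    then have "free_grid_points X Y R = X \<times> Y"
      by (auto simp: free_grid_points_def)
    then have "card (free_grid_points X Y R) = N"
      using n N by (simp add: card_cartesian_product)
    then show ?thesis
      using 1 n sq by simp
  next
    case 2
    obtain s t where st: "st = (s, t)"
      by fastforce
    \<comment> \<open>A single line covers at most one grid point per column, hence at most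
      \<open>n\<close> of the \<open>N\<close> points.\<close>
    have "X \<times> Y - (\<lambda>x. (x, s * x + t)) ` X \<subseteq> free_grid_points X Y R"
      using 2 st by (auto simp: free_grid_points_def)
    then have "card (X \<times> Y - (\<lambda>x. (x, s * x + t)) ` X) \<le> card (free_grid_points X Y R)"
      by (intro card_mono finite_free_grid_points)
    moreover have "card (X \<times> Y) - card ((\<lambda>x. (x, s * x + t)) ` X)
        \<le> card (X \<times> Y - (\<lambda>x. (x, s * x + t)) ` X)"
      using finite_X by (intro diff_card_le_card_Diff) auto
    moreover have "card ((\<lambda>x. (x, s * x + t)) ` X) = n"
      using n by (simp add: card_image inj_on_def)
    moreover have "card (X \<times> Y) = N"
      using n N by (simp add: card_cartesian_product)
    ultimately have "N - n \<le> card (free_grid_points X Y R)"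
      by (metis le_trans)
    then show ?thesis
      using 2 n sq by simp
  next
    case 3
    then obtain x0 y0 where xy: "x0 \<in> X" "y0 \<in> Y" "\<And>s t. (s, t) \<in> R \<Longrightarrow> y0 = s * x0 + t"
      using concurrent by blast
    \<comment> \<open>At \<open>x0\<close> every line has the value \<open>y0\<close>, which frees
      the rest of that column; slopes being nonzero, \<open>y0\<close> is attained nowhere else,
      which frees the rest of that row.\<close>
    define V where "V = {x0} \<times> (Y - {y0})"
    define W where "W = (X - {x0}) \<times> {y0}"
    have "V \<union> W \<subseteq> free_grid_points X Y R"
      using xy slope_nonzero by (fastforce simp: free_grid_points_def V_def W_def)
    then have "card (V \<union> W) \<le> card (free_grid_points X Y R)"
      by (intro card_mono finite_free_grid_points)
    moreover have "card (V \<union> W) = (n - 1) + (n - 1)"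
      using xy n finite_X finite_Y
      by (subst card_Un_disjoint) (auto simp: V_def W_def card_cartesian_product)
    ultimately show ?thesis
      using 3 n by simp
  qed
qed

end

section \<open>Affine coordinates on the projective plane\<close>

text \<open>A basis of the space: \<open>u\<close> is the horizontal direction, \<open>v\<close> the
  vertical direction and \<open>w\<close> the affine origin. The affine point (x, y) has homogeneous
  coordinates (x, y, 1).\<close>

locale projective_frame =
  fixes u v w :: "complex ^ 3"
  assumes independent: "a *s u + b *s v + c *s w = 0 \<Longrightarrow> a = 0 \<and> b = 0 \<and> c = 0"
    and spanning: "\<exists>a b c. z = a *s u + b *s v + c *s w"
begin

definition vec_of :: "complex \<Rightarrow> complex \<Rightarrow> complex \<Rightarrow> complex ^ 3" where
  "vec_of a b c = a *s u + b *s v + c *s w"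

definition point_of :: "complex \<Rightarrow> complex \<Rightarrow> complex \<Rightarrow> flat" where
  "point_of a b c = vec.span {vec_of a b c}"

definition line_at_infinity :: flat where
  "line_at_infinity = {vec_of a b 0 | a b. True}"

definition vertical_line :: "complex \<Rightarrow> flat" where
  "vertical_line x = {vec_of (x * c) b c | b c. True}"

text \<open>Homogeneous form of y = s x + t. Slope 0 gives the horizontal lines, which pass through
  \<open>point_of 1 0 0\<close>.\<close>

definition graph_line :: "complex \<Rightarrow> complex \<Rightarrow> flat" where
  "graph_line s t = {vec_of a (s * a + t * c) c | a c. True}"

section \<open>Coordinate arithmetic and incidence\<close>

lemma vec_of_add: "vec_of a b c + vec_of a' b' c' = vec_of (a + a') (b + b') (c + c')"
  by (simp add: vec_of_def vector_sadd_rdistrib algebra_simps)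

lemma vec_of_scale: "k *s vec_of a b c = vec_of (k * a) (k * b) (k * c)"
  by (simp add: vec_of_def vector_add_ldistrib vector_smult_assoc)

lemma vec_of_diff: "vec_of a b c - vec_of a' b' c' = vec_of (a - a') (b - b') (c - c')"
  by (simp add: vec_of_def vector_ssub_ldistrib vec.scale_left_diff_distrib)

lemma vec_of_eq_0 [simp]: "vec_of a b c = 0 \<longleftrightarrow> a = 0 \<and> b = 0 \<and> c = 0"
  using independent by (auto simp: vec_of_def)

lemma vec_of_eq [simp]: "vec_of a b c = vec_of a' b' c' \<longleftrightarrow> a = a' \<and> b = b' \<and> c = c'"
  using vec_of_eq_0[of "a - a'" "b - b'" "c - c'"] vec_of_diff[of a b c a' b' c'] by auto

lemma vec_of_cases: obtains a b c where "z = vec_of a b c"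
  using spanning[of z] by (auto simp: vec_of_def)

lemma mem_line_at_infinity [simp]: "vec_of a b c \<in> line_at_infinity \<longleftrightarrow> c = 0"
  by (auto simp: line_at_infinity_def)

lemma mem_vertical_line [simp]: "vec_of a b c \<in> vertical_line x \<longleftrightarrow> a = x * c"
  by (auto simp: vertical_line_def)

lemma mem_graph_line [simp]: "vec_of a b c \<in> graph_line s t \<longleftrightarrow> b = s * a + t * c"
  by (auto simp: graph_line_def)

lemma line_at_infinity_neq [simp]:
  "line_at_infinity \<noteq> vertical_line x" "line_at_infinity \<noteq> graph_line s t"
  "vertical_line x \<noteq> line_at_infinity" "graph_line s t \<noteq> line_at_infinity"
  using mem_line_at_infinity[of 1 0 0] mem_vertical_line[of 1 0 0 x]
    mem_line_at_infinity[of 0 1 0] mem_graph_line[of 0 1 0 s t]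
  by (auto simp del: mem_line_at_infinity mem_vertical_line mem_graph_line)

lemma vertical_line_neq_graph_line [simp]:
  "vertical_line x \<noteq> graph_line s t" "graph_line s t \<noteq> vertical_line x"
  using mem_vertical_line[of 0 1 0 x] mem_graph_line[of 0 1 0 s t]
  by (auto simp del: mem_vertical_line mem_graph_line)

lemma vertical_line_eq [simp]: "vertical_line x = vertical_line x' \<longleftrightarrow> x = x'"
  using mem_vertical_line[of x 0 1 x] mem_vertical_line[of x 0 1 x']
  by (auto simp del: mem_vertical_line)

lemma graph_line_eq [simp]: "graph_line s t = graph_line s' t' \<longleftrightarrow> s = s' \<and> t = t'"
  using mem_graph_line[of 0 t 1 s t] mem_graph_line[of 0 t 1 s' t']
    mem_graph_line[of 1 s 0 s t] mem_graph_line[of 1 s 0 s' t']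
  by (auto simp del: mem_graph_line)

lemma subspace_lines:
  "vec.subspace line_at_infinity" "vec.subspace (vertical_line x)" "vec.subspace (graph_line s t)"
proof -
  have zero: "0 = vec_of 0 0 0"
    by simp
  \<comment> \<open>Every vector has the form \<open>vec_of a b c\<close>, so closure may be checked
    on coordinates.\<close>
  have subspaceI: "vec.subspace M"
    if "vec_of 0 0 0 \<in> M"
      and "\<And>a b c a' b' c'. vec_of a b c \<in> M \<Longrightarrow> vec_of a' b' c' \<in> M \<Longrightarrow>
        vec_of (a + a') (b + b') (c + c') \<in> M"
      and "\<And>k a b c. vec_of a b c \<in> M \<Longrightarrow> vec_of (k * a) (k * b) (k * c) \<in> M" for M
    unfolding vec.subspace_def zero
    by (metis that vec_of_add vec_of_scale vec_of_cases)
  show "vec.subspace line_at_infinity" "vec.subspace (vertical_line x)"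
    "vec.subspace (graph_line s t)"
    by (rule subspaceI; simp add: algebra_simps)+
qed

lemma lines_neq_UNIV:
  "line_at_infinity \<noteq> UNIV" "vertical_line x \<noteq> UNIV" "graph_line s t \<noteq> UNIV"
  using mem_line_at_infinity[of 0 0 1] mem_vertical_line[of "x + 1" 0 1 x]
    mem_graph_line[of 0 "t + 1" 1 s t]
  by (auto simp del: mem_line_at_infinity mem_vertical_line mem_graph_line)

section \<open>Classification of the projective lines in a frame\<close>

lemma proj_line_subset_eq:
  assumes "K \<in> proj_lines" "vec.subspace M" "M \<noteq> UNIV" "K \<subseteq> M"
  shows "K = M"
proof -
  \<comment> \<open>A proper subspace has dimension at most 2, so the plane \<open>K\<close> fills
    it. The classification thus needs only inclusions.\<close>
  have "vec.dim M < 3"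
    using assms(2,3) vec.dim_eq_full[of M] vec.dim_subset_UNIV[of M]
      vec.span_eq_iff[THEN iffD2, of M]
    by (simp add: vec.dimension_def card_cart_basis order_less_le)
  then show ?thesis
    using assms by (intro vec.subspace_dim_equal) (auto simp: proj_lines_def)
qed

text \<open>A line other than the one at infinity contains an affine point (x, y, 1). If it also
  contains a direction (1, s, 0), it is the graph of slope \<open>s\<close> through that point;
  otherwise its directions are all vertical.\<close>

lemma proj_line_cases:
  assumes K: "K \<in> proj_lines"
  obtains "K = line_at_infinity" | x where "K = vertical_line x" | s t where "K = graph_line s t"
proof -
  have sub: "vec.subspace K"
    using K by (auto simp: proj_lines_def)
  have scale: "vec_of (k * a) (k * b) (k * c) \<in> K" if "vec_of a b c \<in> K" for k a b c
    using vec.subspace_scale[OF sub that] by (simp add: vec_of_scale)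
  have diff: "vec_of (a - a') (b - b') (c - c') \<in> K"
    if "vec_of a b c \<in> K" "vec_of a' b' c' \<in> K" for a b c a' b' c'
    using vec.subspace_diff[OF sub that] by (simp add: vec_of_diff)
  note eqI = proj_line_subset_eq[OF K]
  show ?thesis
  proof (cases "K \<subseteq> line_at_infinity")
    case True
    then show ?thesis
      by (intro that(1) eqI subspace_lines lines_neq_UNIV)
  next
    case False
    then obtain x' y' c' where "vec_of x' y' c' \<in> K" "c' \<noteq> 0"
      by (metis mem_line_at_infinity subsetI vec_of_cases)
    then obtain x y where f: "vec_of x y 1 \<in> K"
      using scale[of x' y' c' "1 / c'"] by auto
    have f': "vec_of (a - c * x) (b - c * y) 0 \<in> K" if "vec_of a b c \<in> K" for a b c
      using diff[OF that scale[OF f, of c]] by simp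
    show ?thesis
    proof (cases "\<exists>s. vec_of 1 s 0 \<in> K")
      case True
      then obtain s where e: "vec_of 1 s 0 \<in> K" by blast
      \<comment> \<open>Removing the components along the affine point and along the direction
        leaves a vertical remainder, whose vanishing is the equation of the graph. The intercept
        \<open>y - s * x\<close> makes the graph pass through (x, y).\<close>
      have g: "vec_of 0 (b - (s * a + (y - s * x) * c)) 0 \<in> K" if "vec_of a b c \<in> K" for a b c
        using diff[OF f'[OF that] scale[OF e, of "a - c * x"]] by (simp add: algebra_simps)
      \<comment> \<open>With the vertical direction added, \<open>K\<close> would contain three
        independent vectors.\<close>
      have "vec_of 0 1 0 \<notin> K"
      proof
        assume v: "vec_of 0 1 0 \<in> K"
        have "vec_of a b 0 \<in> K" for a b
          using diff[OF scale[OF e, of a] scale[OF v, of "a * s - b"]] by simp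
        from diff[OF scale[OF f] this] have "vec_of a b c \<in> K" for a b c
          by (metis add_diff_cancel_left' diff_add_cancel diff_zero mult.right_neutral)
        then have "K = UNIV"
          by (metis UNIV_eq_I vec_of_cases)
        then show False
          using K by (simp add: proj_lines_def card_cart_basis)
      qed
      then have "b = s * a + (y - s * x) * c" if "vec_of a b c \<in> K" for a b c
        using scale[OF g[OF that], of "1 / (b - (s * a + (y - s * x) * c))"]
        by (cases "b - (s * a + (y - s * x) * c) = 0") auto
      then have "K \<subseteq> graph_line s (y - s * x)"
        by (metis mem_graph_line subsetI vec_of_cases)
      then show ?thesis
        by (intro that(3) eqI subspace_lines lines_neq_UNIV)
    next
      case False
      \<comment> \<open>A direction with nonzero first coordinate could be scaled to the excluded
        form (1, s, 0).\<close>
      have "a = x * c" if "vec_of a b c \<in> K" for a b c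
        using False scale[OF f'[OF that], of "1 / (a - c * x)"]
        by (cases "a - c * x = 0") (auto simp: mult.commute)
      then have "K \<subseteq> vertical_line x"
        by (metis mem_vertical_line subsetI vec_of_cases)
      then show ?thesis
        by (intro that(2) eqI subspace_lines lines_neq_UNIV)
    qed
  qed
qed

lemma point_of_subset_iff: "vec.subspace K \<Longrightarrow> point_of a b c \<subseteq> K \<longleftrightarrow> vec_of a b c \<in> K"
  unfolding point_of_def
  by (meson empty_subsetI insert_subset subset_trans vec.span_minimal vec.span_superset)

lemma point_of_subset [simp]:
  "point_of a b c \<subseteq> line_at_infinity \<longleftrightarrow> c = 0"
  "point_of a b c \<subseteq> vertical_line x \<longleftrightarrow> a = x * c"
  "point_of a b c \<subseteq> graph_line s t \<longleftrightarrow> b = s * a + t * c"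
  by (simp_all add: point_of_subset_iff subspace_lines)

lemma point_of_proj_point: "\<not> (a = 0 \<and> b = 0 \<and> c = 0) \<Longrightarrow> point_of a b c \<in> proj_points"
  by (simp add: proj_points_def point_of_def vec.dim_eq_card_independent)

end

text \<open>Generators of two distinct points are independent, and any vector outside their plane
  completes them to a basis.\<close>

lemma projective_frame_exists:
  assumes "p \<in> proj_points" "q \<in> proj_points" "p \<noteq> q"
  obtains u v w where "projective_frame u v w" "p = vec.span {u}" "q = vec.span {v}"
proof -
  have point: "\<exists>e. e \<noteq> 0 \<and> p = vec.span {e}" if "p \<in> proj_points" for p
  proof -
    have sub: "vec.subspace p" "vec.dim p = 1"
      using that by (auto simp: proj_points_def)
    obtain B where B: "B \<subseteq> p" "vec.independent B" "p \<subseteq> vec.span B" "card B = 1"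
      using vec.basis_exists[of p] sub by metis
    then obtain e where "B = {e}"
      by (meson card_1_singletonE)
    then show ?thesis
      using B sub vec.span_minimal[of B p] by auto
  qed
  obtain u v where uv: "u \<noteq> 0" "p = vec.span {u}" "v \<noteq> 0" "q = vec.span {v}"
    using point assms by metis
  have v: "v \<notin> vec.span {u}"
  proof
    assume "v \<in> vec.span {u}"
    then have "q \<subseteq> p"
      using uv by (simp add: vec.span_minimal)
    then have "q = p"
      using assms by (intro vec.subspace_dim_equal) (auto simp: proj_points_def)
    then show False
      using assms by simp
  qed
  then have ind: "vec.independent {v, u}"
    using uv by (intro vec.independent_insertI) (auto simp: vec.independent_empty)
  have "u \<noteq> v"
    using uv assms by auto
  then have "vec.dim {v, u} = 2"
    using vec.dim_eq_card_independent[OF ind] by simp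
  then have "vec.span {v, u} \<noteq> UNIV"
    using vec.dim_eq_full[of "{v, u}"] by (simp add: vec.dimension_def card_cart_basis)
  then obtain w where w: "w \<notin> vec.span {v, u}"
    by auto
  then have ind': "vec.independent {w, v, u}"
    using ind by (rule vec.independent_insertI)
  have "w \<noteq> u" "w \<noteq> v"
    using w vec.span_base[of _ "{v, u}"] by auto
  then have "vec.dim {w, v, u} = 3"
    using vec.dim_eq_card_independent[OF ind'] \<open>u \<noteq> v\<close> by simp
  then have span: "vec.span {w, v, u} = UNIV"
    using vec.dim_eq_full[of "{w, v, u}"] by (simp add: vec.dimension_def card_cart_basis)
  have "projective_frame u v w"
  proof
    fix z
    have "z \<in> vec.span {w, v, u}"
      using span by simp
    then obtain c b a where "z - c *s w - b *s v = a *s u"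
      by (auto simp: vec.span_breakdown_eq vec.span_singleton)
    then have "z = a *s u + b *s v + c *s w"
      by (simp add: algebra_simps)
    then show "\<exists>a b c. z = a *s u + b *s v + c *s w"
      by blast
  next
    fix a b c
    assume eq: "a *s u + b *s v + c *s w = 0"
    have "c = 0"
    proof (rule ccontr)
      assume "c \<noteq> 0"
      have "c *s w = (-b) *s v + (-a) *s u"
        using eq by (simp add: algebra_simps eq_neg_iff_add_eq_0)
      also have "\<dots> \<in> vec.span {v, u}"
        by (intro vec.span_add vec.span_scale vec.span_base) auto
      finally show False
        using w \<open>c \<noteq> 0\<close> vec.span_scale[of "c *s w" _ "1 / c"] by simp
    qed
    moreover have "b = 0"
    proof (rule ccontr)
      assume "b \<noteq> 0"
      have "b *s v = (-a) *s u"
        using eq \<open>c = 0\<close> by (simp add: algebra_simps eq_neg_iff_add_eq_0)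
      also have "\<dots> \<in> vec.span {u}"
        by (intro vec.span_scale vec.span_base) auto
      finally show False
        using v \<open>b \<noteq> 0\<close> vec.span_scale[of "b *s v" _ "1 / b"] by simp
    qed
    ultimately show "a = 0 \<and> b = 0 \<and> c = 0"
      using eq uv by simp
  qed
  then show ?thesis
    using that uv by blast
qed

section \<open>Counting double points\<close>

text \<open>Two distinct planes meet in dimension below 2, and a one-dimensional subspace of the
  meet fills it.\<close>

lemma proj_point_eq_Int:
  assumes "K \<in> proj_lines" "K' \<in> proj_lines" "K \<noteq> K'" "p \<in> proj_points" "p \<subseteq> K" "p \<subseteq> K'"
  shows "p = K \<inter> K'"
proof -
  have sub: "vec.subspace (K \<inter> K')"
    using assms by (auto simp: proj_lines_def vec.subspace_inter)
  have "vec.dim (K \<inter> K') < 2"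
  proof (rule ccontr)
    assume "\<not> ?thesis"
    then have "K \<inter> K' = K" "K \<inter> K' = K'"
      using assms(1,2) sub
      by (intro vec.subspace_dim_equal; simp add: proj_lines_def)+
    then show False
      using assms by simp
  qed
  then show ?thesis
    using assms sub by (intro vec.subspace_dim_equal) (auto simp: proj_points_def)
qed

text \<open>Every intersection point is the meet of one of finitely many pairs of lines. Finiteness
  is what allows subsets of the double points to bound their \<open>card\<close> from below.\<close>

lemma finite_intersection_points:
  assumes "line_arrangement A"
  shows "finite (intersection_points A)"
proof (rule finite_subset)
  show "finite ((\<lambda>(K, K'). K \<inter> K') ` (A \<times> A))"
    using assms by (auto simp: line_arrangement_def)
  show "intersection_points A \<subseteq> (\<lambda>(K, K'). K \<inter> K') ` (A \<times> A)"
  proof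
    fix p
    assume p: "p \<in> intersection_points A"
    then have "2 \<le> card {L \<in> A. p \<subseteq> L}"
      by (simp add: intersection_points_def multiplicity_at_def)
    then obtain K K' where "K \<in> A" "K' \<in> A" "p \<subseteq> K" "p \<subseteq> K'" "K \<noteq> K'"
    proof -
      have "finite {L \<in> A. p \<subseteq> L}"
        using assms by (simp add: line_arrangement_def)
      from card_le_Suc0_iff_eq[OF this] \<open>2 \<le> _\<close> show ?thesis
        using that by auto
    qed
    moreover from this have "p = K \<inter> K'"
      using p assms
      by (intro proj_point_eq_Int) (auto simp: intersection_points_def line_arrangement_def)
    ultimately show "p \<in> (\<lambda>(K, K'). K \<inter> K') ` (A \<times> A)"
      by auto
  qed
qed

text \<open>With \<open>P\<close> as incidence with a point, the lines through it are read off
  family by family.\<close>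

lemma Collect_Un_images:
  "{K \<in> {a} \<union> f ` X \<union> g ` Y \<union> case_prod h ` R. P K} =
    {K. K = a \<and> P K} \<union> f ` {x \<in> X. P (f x)} \<union> g ` {y \<in> Y. P (g y)}
      \<union> case_prod h ` {(s, t) \<in> R. P (h s t)}"
  by auto

lemma double_pointI:
  assumes "p \<in> proj_points" "{L \<in> A. p \<subseteq> L} = {K, K'}" "K \<noteq> K'"
  shows "p \<in> double_points A"
  using assms by (simp add: double_points_def intersection_points_def multiplicity_at_def)

text \<open>The lines \<open>K\<close> and \<open>K'\<close> make \<open>q\<close> an intersection
  point, so modularity supplies the joining line.\<close>

lemma line_through_modular:
  assumes "line_arrangement A" "p \<in> modular_points A" "q \<in> proj_points" "q \<noteq> p"
    and "K \<in> A" "K' \<in> A" "K \<noteq> K'" "q \<subseteq> K" "q \<subseteq> K'"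
  obtains M where "M \<in> A" "p \<subseteq> M" "q \<subseteq> M"
proof -
  have "card {K, K'} \<le> card {L \<in> A. q \<subseteq> L}"
    using assms by (intro card_mono) (auto simp: line_arrangement_def)
  then have "q \<in> intersection_points A"
    using assms by (simp add: intersection_points_def multiplicity_at_def)
  then have "line_through p q \<in> A"
    using assms by (auto simp: modular_points_def)
  moreover have "p \<subseteq> line_through p q" "q \<subseteq> line_through p q"
    using vec.span_superset[of "p \<union> q"] by (auto simp: line_through_def)
  ultimately show ?thesis
    using that by blast
qed

section \<open>The bound in coordinates\<close>

context projective_frame
begin

lemma point_of_eqD:
  assumes "point_of a b c = point_of a' b' c'"
  obtains k where "a = k * a'" "b = k * b'" "c = k * c'"
proof -
  have "vec_of a b c \<in> vec.span {vec_of a' b' c'}"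
    using assms vec.span_base[of "vec_of a b c" "{vec_of a b c}"] by (simp add: point_of_def)
  then obtain k where "vec_of a b c = k *s vec_of a' b' c'"
    by (auto simp: vec.span_singleton)
  then show ?thesis
    using that[of k] by (simp add: vec_of_scale)
qed

text \<open>Double points are collected from two disjoint sources: the points at infinity of the
  lines in \<open>R\<close> and the free grid points. For a one-point grid the two modular points
  replace the latter.\<close>

lemma double_points_lower_bound:
  assumes arr: "line_arrangement A"
    and p: "point_of 1 0 0 \<in> modular_points A" and q: "point_of 0 1 0 \<in> modular_points A"
    and mult: "multiplicity_at A (point_of 1 0 0) = multiplicity_at A (point_of 0 1 0)"
  shows "card A \<le> 2 * card (double_points A)"
proof -
  \<comment> \<open>Apart from the line at infinity, \<open>X\<close> indexes the lines through the
    vertical direction, \<open>Y\<close> those through the horizontal one, and \<open>R\<close>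
    those through neither.\<close>
  define X where "X = {x. vertical_line x \<in> A}"
  define Y where "Y = {y. graph_line 0 y \<in> A}"
  define R where "R = {(s, t). s \<noteq> 0 \<and> graph_line s t \<in> A}"
  have fin: "finite A"
    using arr by (simp add: line_arrangement_def)
  have lines: "K = line_at_infinity \<or> (\<exists>x. K = vertical_line x) \<or> (\<exists>s t. K = graph_line s t)"
    if "K \<in> A" for K
    using that arr proj_line_cases[of K] by (metis line_arrangement_def subsetD)
  have pq: "point_of 0 1 0 \<noteq> point_of 1 0 0"
    by (metis point_of_subset(2) mult_zero_right zero_neq_one)
  have qi: "point_of 0 1 0 \<in> intersection_points A"
    using q by (simp add: modular_points_def)
  have inf: "line_at_infinity \<in> A"
  proof -
    have "line_through (point_of 1 0 0) (point_of 0 1 0) \<in> A"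
      using p qi pq by (simp add: modular_points_def)
    moreover have "point_of 1 0 0 \<subseteq> line_through (point_of 1 0 0) (point_of 0 1 0)"
      "point_of 0 1 0 \<subseteq> line_through (point_of 1 0 0) (point_of 0 1 0)"
      using vec.span_superset[of "point_of 1 0 0 \<union> point_of 0 1 0"]
      by (auto simp: line_through_def)
    ultimately show ?thesis
      using lines by force
  qed
  \<comment> \<open>The lines joining an affine intersection point to the two modular points are its
    horizontal and its vertical line, so both belong to \<open>A\<close>.\<close>
  have affine: "x \<in> X \<and> y \<in> Y"
    if K: "K \<in> A" "K' \<in> A" "K \<noteq> K'" "point_of x y 1 \<subseteq> K" "point_of x y 1 \<subseteq> K'" for x y K K'
  proof -
    have pt: "point_of x y 1 \<in> proj_points" by (simp add: point_of_proj_point)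
    have "point_of x y 1 \<noteq> point_of 1 0 0" "point_of x y 1 \<noteq> point_of 0 1 0"
      by (metis point_of_subset(1) zero_neq_one)+
    then obtain M N where "M \<in> A" "point_of 1 0 0 \<subseteq> M" "point_of x y 1 \<subseteq> M"
      "N \<in> A" "point_of 0 1 0 \<subseteq> N" "point_of x y 1 \<subseteq> N"
      using line_through_modular[OF arr p pt _ K] line_through_modular[OF arr q pt _ K] by metis
    then show ?thesis
      using lines[of M] lines[of N] by (auto simp: X_def Y_def)
  qed
  have A_eq: "A = {line_at_infinity} \<union> vertical_line ` X \<union> graph_line 0 ` Y \<union> case_prod graph_line ` R"
    using lines inf by (fastforce simp: X_def Y_def R_def)
  have through: "{K \<in> A. P K} = {K. K = line_at_infinity \<and> P K}
      \<union> vertical_line ` {x \<in> X. P (vertical_line x)} \<union> graph_line 0 ` {y \<in> Y. P (graph_line 0 y)}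
      \<union> case_prod graph_line ` {(s, t) \<in> R. P (graph_line s t)}" for P
    by (subst A_eq) (rule Collect_Un_images)
  have finX: "finite X" and finY: "finite Y" and finR: "finite R"
  proof -
    have "finite (vertical_line ` X)" "finite (graph_line 0 ` Y)" "finite (case_prod graph_line ` R)"
      by (rule finite_subset[OF _ fin], force simp: X_def Y_def R_def)+
    then show "finite X" "finite Y" "finite R"
      by (auto elim!: finite_imageD simp: inj_on_def)
  qed
  have "{L \<in> A. point_of 1 0 0 \<subseteq> L} = insert line_at_infinity (graph_line 0 ` Y)"
    unfolding through by (auto simp: R_def conj_commute cong: conj_cong)
  \<comment> \<open>The successor counts the line at infinity.\<close>
  then have mp: "multiplicity_at A (point_of 1 0 0) = Suc (card Y)"
    using finY by (simp add: multiplicity_at_def card_insert_if image_iff card_image inj_on_def)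
  have "{L \<in> A. point_of 0 1 0 \<subseteq> L} = insert line_at_infinity (vertical_line ` X)"
    unfolding through by (auto simp: conj_commute cong: conj_cong)
  then have mq: "multiplicity_at A (point_of 0 1 0) = Suc (card X)"
    using finX by (simp add: multiplicity_at_def card_insert_if image_iff card_image inj_on_def)
  have cardXY: "card X = card Y"
    using mp mq mult by simp
  have "card X \<ge> 1"
    using qi mq by (simp add: intersection_points_def)
  interpret affine_bijections X Y R
  proof
    show "X \<noteq> {}"
      using \<open>card X \<ge> 1\<close> by auto
    show "s * x + t \<in> Y" if "(s, t) \<in> R" "x \<in> X" for s t x
      using affine[of "vertical_line x" "graph_line s t" x "s * x + t"] that
      by (simp add: R_def X_def)
    show "x \<in> X" if "(s, t) \<in> R" "(s', t') \<in> R" "(s, t) \<noteq> (s', t')" "s * x + t = s' * x + t'"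
      for s t s' t' x
      using affine[of "graph_line s t" "graph_line s' t'" x "s * x + t"] that
      by (auto simp: R_def)
    show "s \<noteq> 0" if "(s, t) \<in> R" for s t
      using that by (simp add: R_def)
  qed (fact finX finY finR cardXY)+
  have card_A: "card A = 1 + 2 * card X + card R"
  proof -
    have "card A = card {line_at_infinity} + card (vertical_line ` X) + card (graph_line 0 ` Y)
        + card (case_prod graph_line ` R)"
    proof -
      have "{line_at_infinity} \<inter> vertical_line ` X = {}"
        "({line_at_infinity} \<union> vertical_line ` X) \<inter> graph_line 0 ` Y = {}"
        "({line_at_infinity} \<union> vertical_line ` X \<union> graph_line 0 ` Y) \<inter> case_prod graph_line ` R = {}"
        using slope_nonzero by auto
      then show ?thesis
        using finX finY finR
        by (subst A_eq) (simp only: card_Un_disjoint finite_Un finite_imageI finite.intros)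
    qed
    moreover have "card (vertical_line ` X) = card X" "card (graph_line 0 ` Y) = card Y"
      "card (case_prod graph_line ` R) = card R"
      by (auto intro!: card_image simp: inj_on_def)
    ultimately show ?thesis
      using cardXY by simp
  qed
  define S where "S = (\<lambda>s. point_of 1 s 0) ` fst ` R"
  define G where "G = (\<lambda>(x, y). point_of x y 1) ` free_grid_points X Y R"
  have fin_double: "finite (double_points A)"
    using finite_intersection_points[OF arr] by (simp add: double_points_def)
  have S_double: "S \<subseteq> double_points A"
  proof
    fix z
    assume "z \<in> S"
    then obtain s t where st: "(s, t) \<in> R" "z = point_of 1 s 0"
      by (auto simp: S_def)
    \<comment> \<open>A horizontal line would need \<open>s = 0\<close>, and only one line of
      \<open>R\<close> has slope \<open>s\<close>.\<close>
    have "s \<noteq> 0" "{(s', t') \<in> R. s = s'} = {(s, t)}"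
      using st slope_nonzero slope_determines by auto
    then have "{L \<in> A. z \<subseteq> L} = {line_at_infinity, graph_line s t}"
      unfolding through st by (simp add: insert_commute cong: conj_cong)
    then show "z \<in> double_points A"
      by (rule double_pointI[rotated]) (simp_all add: st point_of_proj_point)
  qed
  have G_double: "G \<subseteq> double_points A"
  proof
    fix z
    assume "z \<in> G"
    then obtain x y where xy: "x \<in> X" "y \<in> Y" "\<And>s t. (s, t) \<in> R \<Longrightarrow> y \<noteq> s * x + t"
      "z = point_of x y 1"
      unfolding G_def free_grid_points_def by blast
    then have "{x' \<in> X. x = x'} = {x}" "{y' \<in> Y. y = y'} = {y}"
      "{(s, t) \<in> R. y = s * x + t} = {}"
      by auto
    then have "{L \<in> A. z \<subseteq> L} = {vertical_line x, graph_line 0 y}"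
      unfolding through xy by (simp add: insert_commute cong: conj_cong)
    then show "z \<in> double_points A"
      by (rule double_pointI[rotated]) (simp_all add: xy point_of_proj_point)
  qed
  have card_S: "card S = card R"
  proof -
    have "inj_on (\<lambda>s. point_of 1 s 0) (fst ` R)"
      by (auto simp: inj_on_def elim!: point_of_eqD)
    then show ?thesis
      using inj_on_slope by (simp add: S_def card_image)
  qed
  have fin_S: "finite S"
    using finR by (simp add: S_def)
  show ?thesis
  proof (cases "card X = 1")
    \<comment> \<open>Here both modular points have multiplicity 2. Having slope 0 and no finite
      slope respectively, they lie outside \<open>S\<close>, so there are at least
      \<open>card R + 2\<close> double points against \<open>card R + 3\<close> lines.\<close>
    case True
    have "point_of 1 0 0 \<in> double_points A" "point_of 0 1 0 \<in> double_points A"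
      using True mp mq cardXY p q by (auto simp: double_points_def modular_points_def)
    then have "insert (point_of 0 1 0) (insert (point_of 1 0 0) S) \<subseteq> double_points A"
      using S_double by simp
    then have "card (insert (point_of 0 1 0) (insert (point_of 1 0 0) S)) \<le> card (double_points A)"
      by (rule card_mono[OF fin_double])
    moreover have "point_of 0 1 0 \<notin> S" "point_of 1 0 0 \<notin> S"
      using slope_nonzero by (fastforce simp: S_def elim!: point_of_eqD)+
    ultimately show ?thesis
      using True fin_S pq card_S card_A by simp
  next
    case False
    have "S \<inter> G = {}"
      by (auto simp: S_def G_def elim!: point_of_eqD)
    moreover have "finite G"
      by (simp add: G_def finite_free_grid_points)
    ultimately have "card (S \<union> G) = card S + card G"
      using fin_S by (intro card_Un_disjoint)
    moreover have "card G = card (free_grid_points X Y R)"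
      unfolding G_def by (rule card_image) (auto simp: inj_on_def elim!: point_of_eqD)
    moreover have "card (S \<union> G) \<le> card (double_points A)"
      using S_double G_double by (intro card_mono[OF fin_double]) simp
    moreover have "card X \<ge> 2"
      using False \<open>card X \<ge> 1\<close> by simp
    ultimately show ?thesis
      using card_free_grid_points card_S card_A by simp
  qed
qed

end

theorem corollary1p6:
  fixes A :: "flat set" and m d :: nat
  assumes "line_arrangement A"
    and "homogeneous_supersolvable m A"
    and "d = card A"
    and "\<exists>p \<in> modular_points A. \<exists>q \<in> modular_points A. p \<noteq> q"
  shows "real (card (double_points A)) \<ge> real d / 2"
proof -
  obtain p q where pq: "p \<in> modular_points A" "q \<in> modular_points A" "p \<noteq> q"
    using assms(4) by blast
  moreover from this have "p \<in> proj_points" "q \<in> proj_points"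
    by (auto simp: modular_points_def intersection_points_def)
  ultimately obtain u v w where frame: "projective_frame u v w"
    and span: "p = vec.span {u}" "q = vec.span {v}"
    using projective_frame_exists by blast
  interpret projective_frame u v w
    by (rule frame)
  have "p = point_of 1 0 0" "q = point_of 0 1 0"
    by (simp_all add: span point_of_def vec_of_def)
  \<comment> \<open>Homogeneity makes the grid square.\<close>
  moreover have "multiplicity_at A p = multiplicity_at A q"
    using assms(2) pq by (simp add: homogeneous_supersolvable_def)
  ultimately have "card A \<le> 2 * card (double_points A)"
    using double_points_lower_bound assms(1) pq by simp
  then show ?thesis
    using assms(3) by simp
qed

end
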